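(* Let $v_{\infty 1}>v_{\infty 2}>0$ and $n_1>n_2>1$, and let $\sigma=\sigma(O,\Phi)$ denote the shock speed. The Hugoniot locus of the origin $O=(0,0)^{\mathrm T}$ is $\mathcal H(O)=\partial^1\cup\partial^2\cup\mathcal C(\Phi^{\mathrm x})\cup\mathcal C(\Phi^\infty)$. For $\Phi\in\mathcal H(O)$ the Riemann problem $\mathrm{RP}(O,\Phi)$ is solved by a single shock of speed $\sigma(O,\Phi)$, and this shock is classified as follows. (A relation such as $\lambda_{1,2}(\Phi)<\sigma$ means that it holds for both $\lambda_1(\Phi)$ and $\lambda_2(\Phi)$.) Put $\phi^\sigma:=1-(v_{\infty2}/v_{\infty1})^{1/n_1}$. (i) $\Phi=(\phi_1,0)^{\mathrm T}\in\partial^1$: - if $\phi_1\in(0,\phi^\sigma)$, the shock is 2-Lax, with $\lambda_{1,2}(\Phi)\le\sigma<\lambda_2(O)$ and $\lambda_1(O)<\sigma$; - if $\phi_1=\phi^\sigma$, the shock is 2-Lax, with $\lambda_{1,2}(\Phi)\le\sigma<\lambda_2(O)$ and $\lambda_1(O)=\sigma$; - if $\phi_1\in(\phi^\sigma,\phi^{\mathrm x})$, the shock is over-compressive, with $\lambda_{1,2}(\Phi)<\sigma<\lambda_{1,2}(O)$; - if $\phi_1=\phi^{\mathrm x}$, the shock is 1-Lax, with $\lambda_1(\Phi)<\sigma<\lambda_{1,2}(O)$ and $\sigma=\lambda_2(\Phi)$; - if $\phi_1=1$, the shock is 1-Lax, with $\lambda_1(\Phi)=\sigma<\lambda_{1,2}(O)$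 and $\sigma=\lambda_2(\Phi)$; - if $\phi_1\in(\phi^{\mathrm x},1)$, the shock is 1-Lax, with $\lambda_1(\Phi)<\sigma<\lambda_{1,2}(O)$ and $\sigma<\lambda_2(\Phi)$. (ii) $\Phi=(0,\phi_2)^{\mathrm T}\in\partial^2$: - if $\phi_2\in(0,\phi^{\mathrm x})$, the shock is 1-Lax, with $\lambda_1(\Phi)<\sigma<\lambda_{1,2}(O)$ and $\sigma<\lambda_2(\Phi)$; - if $\phi_2=\phi^{\mathrm x}$, the shock is 1-Lax, with $\lambda_1(\Phi)<\sigma<\lambda_{1,2}(O)$ and $\sigma=\lambda_2(\Phi)$; - if $\phi_2=1$, the shock is 1-Lax, with $\lambda_1(\Phi)=\sigma<\lambda_{1,2}(O)$ and $\sigma=\lambda_2(\Phi)$; - if $\phi_2\in(\phi^{\mathrm x},1)$, the shock is over-compressive, with $\lambda_{1,2}(\Phi)<\sigma<\lambda_{1,2}(O)$. (iii) $\Phi\in\mathcal C(\Phi^{\mathrm x})$: the shock is 1-Lax, with $\lambda_1(\Phi)<\sigma<\lambda_{1,2}(O)$ and $\sigma=\lambda_2(\Phi)$. (iv) $\Phi\in\mathcal C(\Phi^\infty)$: the shock is 1-Lax, with $\lambda_1(\Phi)=\sigma<\lambda_{1,2}(O)$ and $\sigma=\lambda_2(\Phi)$.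
   Context: Phase space: $\mathcal D=\{\Phi=(\phi_1,\phi_2)^{\mathrm T}\in\mathbb R^2:\phi_1\ge0,\ \phi_2\ge0,\ \phi:=\phi_1+\phi_2\le 1\}$ (maximum packing concentration equal to $1$). On $\mathcal D$ set $u_i(\Phi)=v_{\infty i}(1-\phi)^{n_i-1}$, $v_i(\Phi)=u_i(\Phi)-\phi_1u_1(\Phi)-\phi_2u_2(\Phi)$, $f_i(\Phi)=\phi_iv_i(\Phi)$ for $i=1,2$, and $\boldsymbol f=(f_1,f_2)^{\mathrm T}$. The system is $\partial_t\phi_i+\partial_xf_i(\Phi)=0$, $i=1,2$. $\mathrm{RP}(\Phi^-,\Phi^+)$ is the Cauchy problem for this system with data $\Phi^-$ for $x<0$ and $\Phi^+$ for $x>0$. The Hugoniot locus $\mathcal H(\Phi^-)$ is the set of $\Phi^+\in\mathcal D$ for which there is a real $\sigma=\sigma(\Phi^-,\Phi^+)$ (the shock speed) with $\boldsymbol f(\Phi^+)-\boldsymbol f(\Phi^-)=\sigma(\Phi^+-\Phi^-)$. $\lambda_1\le\lambda_2$ are the eigenvalues of the Jacobian matrix of $\boldsymbol f$, given by $\lambda_{1,2}=\tfrac12(v_1+v_2)-\tfrac12(n_1\phi_1u_1+n_2\phi_2u_2)\mp\tfrac12\sqrt{\Delta_\Phi}$, with $\Delta_\Phi=[(n_1\phi_1-1)u_1-(n_2\phi_2-1)u_2]^2+4n_1n_2\phi_1\phi_2u_1u_2$; at states with $\phi=1$ they are understood through this formula. Sets: $\partial^1=\{(\phi,0)^{\mathrm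 T}:\phi\in[0,1]\}$, $\partial^2=\{(0,\phi)^{\mathrm T}:\phi\in[0,1]\}$, $\mathcal C(\Phi^{\mathrm x})=\{\Phi\in\mathcal D:\phi_1+\phi_2=\phi^{\mathrm x}\}$ with $\phi^{\mathrm x}=1-(v_{\infty2}/v_{\infty1})^{1/(n_1-n_2)}$, and $\mathcal C(\Phi^\infty)=\{\Phi\in\mathcal D:\phi_1+\phi_2=1\}$. Shock types, for a left state $\Phi^-$ and a right state $\Phi^+$ satisfying the Rankine–Hugoniot condition with speed $\sigma$: - 1-Lax: $\lambda_1(\Phi^+)\le\sigma\le\lambda_1(\Phi^-)$ and $\sigma\le\lambda_2(\Phi^+)$; - 2-Lax: $\lambda_2(\Phi^+)\le\sigma\le\lambda_2(\Phi^-)$ and $\lambda_1(\Phi^-)\le\sigma$; - over-compressive: $\lambda_2(\Phi^+)<\sigma<\lambda_1(\Phi^-)$. *)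

theory Defs
  imports "HOL-Analysis.Analysis"
begin

text \<open>
  States are vectors in \<^typ>\<open>real^2\<close>. The vectors \<open>w\<close> and \<open>n\<close> collect the
  parameters: \<open>w $ i\<close> is $v_{\infty i}$ and \<open>n $ i\<close> is the (real) exponent $n_i$.
\<close>

definition conc :: "real^2 \<Rightarrow> real" where
  "conc \<Phi> = \<Phi> $ 1 + \<Phi> $ 2"

definition phase_space :: "(real^2) set" where
  "phase_space = {\<Phi>. 0 \<le> \<Phi> $ 1 \<and> 0 \<le> \<Phi> $ 2 \<and> conc \<Phi> \<le> 1}"

definition slip :: "real^2 \<Rightarrow> real^2 \<Rightarrow> 2 \<Rightarrow> real^2 \<Rightarrow> real" where
  "slip w n i \<Phi> = w $ i * (1 - conc \<Phi>) powr (n $ i - 1)"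

definition vel :: "real^2 \<Rightarrow> real^2 \<Rightarrow> 2 \<Rightarrow> real^2 \<Rightarrow> real" where
  "vel w n i \<Phi> = slip w n i \<Phi> - \<Phi> $ 1 * slip w n 1 \<Phi> - \<Phi> $ 2 * slip w n 2 \<Phi>"

definition flux :: "real^2 \<Rightarrow> real^2 \<Rightarrow> real^2 \<Rightarrow> real^2" where
  "flux w n \<Phi> = (\<chi> i. \<Phi> $ i * vel w n i \<Phi>)"

definition discr :: "real^2 \<Rightarrow> real^2 \<Rightarrow> real^2 \<Rightarrow> real" where
  "discr w n \<Phi> =
     ((n $ 1 * \<Phi> $ 1 - 1) * slip w n 1 \<Phi> - (n $ 2 * \<Phi> $ 2 - 1) * slip w n 2 \<Phi>)\<^sup>2
     + 4 * (n $ 1) * (n $ 2) * \<Phi> $ 1 * \<Phi> $ 2 * slip w n 1 \<Phi> * slip w n 2 \<Phi>"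

text \<open>
  The eigenvalues of the Jacobian matrix of \<^const>\<open>flux\<close>, in closed form. The closed
  form also fixes their value where the total concentration is 1; below that
  value, the lemmas at the end of this theory show that these are the
  eigenvalues of the Jacobian matrix, in increasing order and with multiplicity.
\<close>

definition lam1 :: "real^2 \<Rightarrow> real^2 \<Rightarrow> real^2 \<Rightarrow> real" where
  "lam1 w n \<Phi> =
     1/2 * (vel w n 1 \<Phi> + vel w n 2 \<Phi>)
     - 1/2 * (n $ 1 * \<Phi> $ 1 * slip w n 1 \<Phi> + n $ 2 * \<Phi> $ 2 * slip w n 2 \<Phi>)
     - 1/2 * sqrt (discr w n \<Phi>)"

definition lam2 :: "real^2 \<Rightarrow> real^2 \<Rightarrow> real^2 \<Rightarrow> real" where
  "lam2 w n \<Phi> =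
     1/2 * (vel w n 1 \<Phi> + vel w n 2 \<Phi>)
     - 1/2 * (n $ 1 * \<Phi> $ 1 * slip w n 1 \<Phi> + n $ 2 * \<Phi> $ 2 * slip w n 2 \<Phi>)
     + 1/2 * sqrt (discr w n \<Phi>)"

definition rankine_hugoniot ::
    "real^2 \<Rightarrow> real^2 \<Rightarrow> real^2 \<Rightarrow> real^2 \<Rightarrow> real \<Rightarrow> bool" where
  "rankine_hugoniot w n \<Phi>m \<Phi>p \<sigma> \<longleftrightarrow> flux w n \<Phi>p - flux w n \<Phi>m = \<sigma> *\<^sub>R (\<Phi>p - \<Phi>m)"

definition hugoniot :: "real^2 \<Rightarrow> real^2 \<Rightarrow> real^2 \<Rightarrow> (real^2) set" where
  "hugoniot w n \<Phi>m = {\<Phi>p \<in> phase_space. \<exists>\<sigma>. rankine_hugoniot w n \<Phi>m \<Phi>p \<sigma>}"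

lemma rankine_hugoniot_speed_unique:
  assumes "rankine_hugoniot w n \<Phi>m \<Phi>p \<sigma>" "rankine_hugoniot w n \<Phi>m \<Phi>p \<sigma>'" "\<Phi>p \<noteq> \<Phi>m"
  shows "\<sigma> = \<sigma>'"
  using assms by (simp add: rankine_hugoniot_def)

definition lax_1 :: "real^2 \<Rightarrow> real^2 \<Rightarrow> real^2 \<Rightarrow> real^2 \<Rightarrow> real \<Rightarrow> bool" where
  "lax_1 w n \<Phi>m \<Phi>p \<sigma> \<longleftrightarrow> rankine_hugoniot w n \<Phi>m \<Phi>p \<sigma> \<and>
     lam1 w n \<Phi>p \<le> \<sigma> \<and> \<sigma> \<le> lam1 w n \<Phi>m \<and> \<sigma> \<le> lam2 w n \<Phi>p"

definition lax_2 :: "real^2 \<Rightarrow> real^2 \<Rightarrow> real^2 \<Rightarrow> real^2 \<Rightarrow> real \<Rightarrow> bool" where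
  "lax_2 w n \<Phi>m \<Phi>p \<sigma> \<longleftrightarrow> rankine_hugoniot w n \<Phi>m \<Phi>p \<sigma> \<and>
     lam2 w n \<Phi>p \<le> \<sigma> \<and> \<sigma> \<le> lam2 w n \<Phi>m \<and> lam1 w n \<Phi>m \<le> \<sigma>"

definition overcompressive :: "real^2 \<Rightarrow> real^2 \<Rightarrow> real^2 \<Rightarrow> real^2 \<Rightarrow> real \<Rightarrow> bool" where
  "overcompressive w n \<Phi>m \<Phi>p \<sigma> \<longleftrightarrow> rankine_hugoniot w n \<Phi>m \<Phi>p \<sigma> \<and>
     lam2 w n \<Phi>p < \<sigma> \<and> \<sigma> < lam1 w n \<Phi>m"

definition edge1 :: "(real^2) set" where
  "edge1 = {vector [p, 0] | p. 0 \<le> p \<and> p \<le> 1}"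

definition edge2 :: "(real^2) set" where
  "edge2 = {vector [0, p] | p. 0 \<le> p \<and> p \<le> 1}"

definition level_set :: "real \<Rightarrow> (real^2) set" where
  "level_set c = {\<Phi> \<in> phase_space. conc \<Phi> = c}"

text \<open>The total concentration at which both slip velocities agree.\<close>

definition phi_x :: "real^2 \<Rightarrow> real^2 \<Rightarrow> real" where
  "phi_x w n = 1 - (w $ 2 / w $ 1) powr (1 / (n $ 1 - n $ 2))"

definition phi_sigma :: "real^2 \<Rightarrow> real^2 \<Rightarrow> real" where
  "phi_sigma w n = 1 - (w $ 2 / w $ 1) powr (1 / n $ 1)"

text \<open>
  Points of space-time are pairs \<open>(x, t)\<close>. A test function is continuously
  differentiable with compact support on the whole plane, so it need not vanish
  at \<open>t = 0\<close>, and the initial data enter the weak formulation.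
\<close>

definition test_function ::
    "(real \<times> real \<Rightarrow> real) \<Rightarrow> (real \<times> real \<Rightarrow> real) \<Rightarrow> (real \<times> real \<Rightarrow> real) \<Rightarrow> bool" where
  "test_function \<psi> \<psi>x \<psi>t \<longleftrightarrow>
     continuous_on UNIV \<psi> \<and> continuous_on UNIV \<psi>x \<and> continuous_on UNIV \<psi>t \<and>
     (\<forall>x t. ((\<lambda>y. \<psi> (y, t)) has_real_derivative \<psi>x (x, t)) (at x)) \<and>
     (\<forall>x t. ((\<lambda>s. \<psi> (x, s)) has_real_derivative \<psi>t (x, t)) (at t)) \<and>
     (\<exists>K. compact K \<and> (\<forall>z. z \<notin> K \<longrightarrow> \<psi> z = 0))"

text \<open>
  Weak solutions of the Cauchy problem with initial data \<open>U0\<close>. On the half plane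
  \<open>t \<ge> 0\<close>, \<open>U\<close> is measurable with values in the compact set \<^const>\<open>phase_space\<close>, on
  which the flux is continuous if \<open>n $ i > 1\<close>, and \<open>\<psi>x\<close>, \<open>\<psi>t\<close> have compact support. So the
  space-time integrand is integrable and the integral is not a default value.
\<close>

definition weak_solution ::
    "real^2 \<Rightarrow> real^2 \<Rightarrow> (real \<Rightarrow> real^2) \<Rightarrow> (real \<times> real \<Rightarrow> real^2) \<Rightarrow> bool" where
  "weak_solution w n U0 U \<longleftrightarrow>
     U \<in> borel_measurable borel \<and> (\<forall>x t. 0 \<le> t \<longrightarrow> U (x, t) \<in> phase_space) \<and>
     (\<forall>\<psi> \<psi>x \<psi>t. test_function \<psi> \<psi>x \<psi>t \<longrightarrow>
        (LINT z:UNIV \<times> {0..}|lborel. \<psi>t z *\<^sub>R U z + \<psi>x z *\<^sub>R flux w n (U z))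
        + (LINT x|lborel. \<psi> (x, 0) *\<^sub>R U0 x) = 0)"

definition riemann_data :: "real^2 \<Rightarrow> real^2 \<Rightarrow> real \<Rightarrow> real^2" where
  "riemann_data \<Phi>m \<Phi>p x = (if x < 0 then \<Phi>m else \<Phi>p)"

definition shock_wave :: "real \<Rightarrow> real^2 \<Rightarrow> real^2 \<Rightarrow> real \<times> real \<Rightarrow> real^2" where
  "shock_wave \<sigma> \<Phi>m \<Phi>p = (\<lambda>(x, t). if x < \<sigma> * t then \<Phi>m else \<Phi>p)"


lemma has_derivative_flux:
  fixes w n \<Phi> :: "real^2"
  assumes "conc \<Phi> < 1"
  defines "p \<equiv> \<lambda>i. (n $ i - 1) * slip w n i \<Phi> / (1 - conc \<Phi>)"
  defines "S \<equiv> \<Phi> $ 1 * p 1 + \<Phi> $ 2 * p 2"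
  shows "(flux w n has_derivative
           (\<lambda>h. (\<chi> i j. (if i = j then vel w n i \<Phi> else 0)
                        + \<Phi> $ i * (S - p i - slip w n j \<Phi>)) *v h)) (at \<Phi>)"
proof -
  have dc: "((\<lambda>\<Phi>::real^2. 1 - conc \<Phi>) has_derivative (\<lambda>h. - (h $ 1 + h $ 2))) (at \<Phi>)"
    unfolding conc_def
    by (auto intro!: derivative_eq_intros bounded_linear.has_derivative[OF bounded_linear_vec_nth])
  have du: "(slip w n i has_derivative (\<lambda>h. - p i * (h $ 1 + h $ 2))) (at \<Phi>)" for i
  proof -
    have "((\<lambda>\<Phi>::real^2. w $ i * (1 - conc \<Phi>) powr (n $ i - 1)) has_derivative
            (\<lambda>h. w $ i * ((1 - conc \<Phi>) powr (n $ i - 1)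
                   * (0 * ln (1 - conc \<Phi>) + - (h $ 1 + h $ 2) * (n $ i - 1) / (1 - conc \<Phi>))))) (at \<Phi>)"
      by (rule has_derivative_mult_right, rule has_derivative_powr[OF dc has_derivative_const])
         (use assms in auto)
    moreover have "slip w n i = (\<lambda>\<Phi>. w $ i * (1 - conc \<Phi>) powr (n $ i - 1))"
      by (auto simp: slip_def)
    moreover have "(\<lambda>h :: real^2. w $ i * ((1 - conc \<Phi>) powr (n $ i - 1)
                   * (0 * ln (1 - conc \<Phi>) + - (h $ 1 + h $ 2) * (n $ i - 1) / (1 - conc \<Phi>))))
        = (\<lambda>h. - p i * (h $ 1 + h $ 2))"
      using assms(1) by (auto simp: p_def slip_def fun_eq_iff field_simps)
    ultimately show ?thesis by (simp only:)
  qed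
  have dphi: "((\<lambda>\<Phi>::real^2. \<Phi> $ i) has_derivative (\<lambda>h. h $ i)) (at \<Phi>)" for i
    by (rule bounded_linear.has_derivative[OF bounded_linear_vec_nth has_derivative_ident])
  have "((\<lambda>\<Phi>. flux w n \<Phi> $ i) has_derivative
         (\<lambda>h. ((\<chi> i j. (if i = j then vel w n i \<Phi> else 0)
                        + \<Phi> $ i * (S - p i - slip w n j \<Phi>)) *v h) $ i)) (at \<Phi>)" for i
  proof -
    have "((\<lambda>\<Phi>. \<Phi> $ i * (slip w n i \<Phi> - \<Phi> $ 1 * slip w n 1 \<Phi> - \<Phi> $ 2 * slip w n 2 \<Phi>))
            has_derivative
          (\<lambda>h. \<Phi> $ i * (- p i * (h $ 1 + h $ 2)
               - (\<Phi> $ 1 * (- p 1 * (h $ 1 + h $ 2)) + h $ 1 * slip w n 1 \<Phi>)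
               - (\<Phi> $ 2 * (- p 2 * (h $ 1 + h $ 2)) + h $ 2 * slip w n 2 \<Phi>))
             + h $ i * (slip w n i \<Phi> - \<Phi> $ 1 * slip w n 1 \<Phi> - \<Phi> $ 2 * slip w n 2 \<Phi>))) (at \<Phi>)"
      by (intro has_derivative_mult has_derivative_diff du dphi)
    moreover have "(\<lambda>h. \<Phi> $ i * (- p i * (h $ 1 + h $ 2)
               - (\<Phi> $ 1 * (- p 1 * (h $ 1 + h $ 2)) + h $ 1 * slip w n 1 \<Phi>)
               - (\<Phi> $ 2 * (- p 2 * (h $ 1 + h $ 2)) + h $ 2 * slip w n 2 \<Phi>))
             + h $ i * (slip w n i \<Phi> - \<Phi> $ 1 * slip w n 1 \<Phi> - \<Phi> $ 2 * slip w n 2 \<Phi>))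
       = (\<lambda>h. ((\<chi> i j. (if i = j then vel w n i \<Phi> else 0)
                        + \<Phi> $ i * (S - p i - slip w n j \<Phi>)) *v h) $ i)"
      using exhaust_2[of i]
      by (auto simp: fun_eq_iff matrix_vector_mult_def sum_2 vel_def S_def algebra_simps)
    ultimately show ?thesis by (simp add: flux_def vel_def)
  qed
  then show ?thesis
    by (subst has_derivative_componentwise_within)
       (auto simp: Basis_vec_def inner_axis)
qed

lemma lam1_le_lam2:
  assumes "\<Phi> \<in> phase_space" "w $ 1 > 0" "w $ 2 > 0" "n $ 1 > 0" "n $ 2 > 0"
  shows "0 \<le> discr w n \<Phi>" and "lam1 w n \<Phi> \<le> lam2 w n \<Phi>"
proof -
  show "0 \<le> discr w n \<Phi>"
    using assms by (auto simp: discr_def phase_space_def slip_def intro!: add_nonneg_nonneg mult_nonneg_nonneg)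
  then show "lam1 w n \<Phi> \<le> lam2 w n \<Phi>"
    by (simp add: lam1_def lam2_def)
qed

lemma charpoly_jacobian_flux:
  assumes "\<Phi> \<in> phase_space" "conc \<Phi> < 1"
    and "w $ 1 > 0" "w $ 2 > 0" "n $ 1 > 0" "n $ 2 > 0"
  shows "det (jacobian (flux w n) (at \<Phi>) - mat \<mu>) = (lam1 w n \<Phi> - \<mu>) * (lam2 w n \<Phi> - \<mu>)"
proof -
  define d u1 u2 a b where "d = 1 - conc \<Phi>" "u1 = slip w n 1 \<Phi>" "u2 = slip w n 2 \<Phi>"
    "a = \<Phi> $ 1" "b = \<Phi> $ 2"
  note defs = this
  define p1 p2 where "p1 = (n $ 1 - 1) * u1 / d" "p2 = (n $ 2 - 1) * u2 / d"
  note pdefs = this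
  have d: "d > 0" using assms defs by simp
  have ab: "d = 1 - a - b" using defs by (simp add: conc_def)
  define J :: "real^2^2" where
    "J = (\<chi> i j. (if i = j then vel w n i \<Phi> else 0) + \<Phi> $ i * (a * p1 + b * p2
       - (n $ i - 1) * slip w n i \<Phi> / d - slip w n j \<Phi>))"
  have der: "(flux w n has_derivative (\<lambda>h. J *v h)) (at \<Phi>)"
    using has_derivative_flux[OF assms(2), of w n] by (simp add: J_def defs pdefs)
  have Jeq: "jacobian (flux w n) (at \<Phi>) = J"
    unfolding jacobian_def frechet_derivative_at[OF der, symmetric]
    by (rule matrix_of_matrix_vector_mul)
  have e: "n $ 1 * u1 = u1 + p1 * d" "n $ 2 * u2 = u2 + p2 * d"
    using d by (auto simp: pdefs field_simps)
  have sq: "(sqrt (discr w n \<Phi>))\<^sup>2 = discr w n \<Phi>"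
    using lam1_le_lam2(1)[of \<Phi> w n] assms by simp
  have dis: "discr w n \<Phi> = ((a * (u1 + p1 * d) - u1) - (b * (u2 + p2 * d) - u2))\<^sup>2
      + 4 * a * b * (u1 + p1 * d) * (u2 + p2 * d)"
    unfolding discr_def e[symmetric] defs[symmetric] by (simp add: algebra_simps)
  define T where "T = (u1 - a * u1 - b * u2) + (u2 - a * u1 - b * u2) - (a * (u1 + p1 * d) + b * (u2 + p2 * d))"
  have "vel w n 1 \<Phi> + vel w n 2 \<Phi>
     - (n $ 1 * \<Phi> $ 1 * slip w n 1 \<Phi> + n $ 2 * \<Phi> $ 2 * slip w n 2 \<Phi>) = T"
    unfolding T_def e[symmetric] vel_def defs[symmetric] by (simp add: algebra_simps)
  then have l: "lam1 w n \<Phi> = (T - sqrt (discr w n \<Phi>)) / 2"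
    "lam2 w n \<Phi> = (T + sqrt (discr w n \<Phi>)) / 2"
    by (simp_all add: lam1_def lam2_def field_simps)
  have "(lam1 w n \<Phi> - \<mu>) * (lam2 w n \<Phi> - \<mu>) = ((T - 2 * \<mu>)\<^sup>2 - discr w n \<Phi>) / 4"
  proof -
    have "((T - s) / 2 - \<mu>) * ((T + s) / 2 - \<mu>) = ((T - 2 * \<mu>)\<^sup>2 - s\<^sup>2) / 4" for s
      by (simp add: power2_eq_square field_simps)
    then show ?thesis by (simp only: l sq)
  qed
  also have "\<dots> = (J $ 1 $ 1 - \<mu>) * (J $ 2 $ 2 - \<mu>) - J $ 1 $ 2 * J $ 2 $ 1"
  proof -
    have J: "J $ 1 $ 1 = u1 - a * u1 - b * u2 + a * (a * p1 + b * p2 - p1 - u1)"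
      "J $ 2 $ 2 = u2 - a * u1 - b * u2 + b * (a * p1 + b * p2 - p2 - u2)"
      "J $ 1 $ 2 = a * (a * p1 + b * p2 - p1 - u2)"
      "J $ 2 $ 1 = b * (a * p1 + b * p2 - p2 - u1)"
      unfolding J_def vel_def by (simp_all add: defs[symmetric] pdefs[symmetric])
    have "T = J $ 1 $ 1 + J $ 2 $ 2"
      unfolding J T_def ab by (simp add: algebra_simps)
    moreover have "discr w n \<Phi> = (J $ 1 $ 1 - J $ 2 $ 2)\<^sup>2 + 4 * J $ 1 $ 2 * J $ 2 $ 1"
      unfolding dis J ab by (simp add: algebra_simps power2_eq_square)
    moreover have "((x + y - 2 * \<mu>)\<^sup>2 - ((x - y)\<^sup>2 + 4 * p * q)) / 4 = (x - \<mu>) * (y - \<mu>) - p * q"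
      for x y p q :: real
      by (simp add: power2_eq_square field_simps)
    ultimately show ?thesis by (simp only:)
  qed
  finally show ?thesis
    by (simp add: Jeq det_2 mat_def)
qed

lemma eigenvalues_jacobian_flux:
  assumes "\<Phi> \<in> phase_space" "conc \<Phi> < 1"
    and "w $ 1 > 0" "w $ 2 > 0" "n $ 1 > 0" "n $ 2 > 0"
  shows "(\<exists>r. r \<noteq> 0 \<and> jacobian (flux w n) (at \<Phi>) *v r = \<mu> *\<^sub>R r) \<longleftrightarrow>
         \<mu> = lam1 w n \<Phi> \<or> \<mu> = lam2 w n \<Phi>"
proof -
  let ?A = "jacobian (flux w n) (at \<Phi>) - mat \<mu>"
  have m: "mat \<mu> *v r = \<mu> *\<^sub>R r" for r :: "real^2"
    by (auto simp: vec_eq_iff matrix_vector_mult_def mat_def if_distrib if_distribR cong: if_cong)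
  have "(\<exists>r. r \<noteq> 0 \<and> jacobian (flux w n) (at \<Phi>) *v r = \<mu> *\<^sub>R r) \<longleftrightarrow> (\<exists>r. r \<noteq> 0 \<and> ?A *v r = 0)"
    by (simp add: matrix_vector_mult_diff_rdistrib m)
  also have "\<dots> \<longleftrightarrow> det ?A = 0"
    using invertible_det_nz[of ?A] matrix_left_invertible_ker[of ?A]
    unfolding invertible_left_inverse by blast
  also have "\<dots> \<longleftrightarrow> \<mu> = lam1 w n \<Phi> \<or> \<mu> = lam2 w n \<Phi>"
    by (subst charpoly_jacobian_flux[OF assms]) auto
  finally show ?thesis .
qed

end

theory Submission
  imports Defs
begin

text \<open>
  A common factor \<open>\<Phi> $ i\<close> cancels from the Rankine--Hugoniot condition with left state \<open>0\<close>, so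
  in the interior it says that both velocities, hence both slip velocities, agree: the total
  concentration is \<^term>\<open>phi_x w n\<close> or \<open>1\<close>. On each branch of the Hugoniot locus the discriminant
  is a perfect square, and every comparison reduces to the signs of \<open>slip w n 1 - slip w n 2\<close> and
  \<open>\<sigma> - w $ 2\<close>. That a shock is a weak solution follows by shearing the
  discontinuity to a vertical line, where Fubini and the fundamental theorem of calculus apply.
\<close>

subsection \<open>Shock waves as weak solutions\<close>

text \<open>The support condition in \<open>test_function\<close> is on \<open>\<psi>\<close> alone.
  Since the complement of \<open>K\<close> is open, \<open>\<psi>\<close> is locally zero along both
  coordinate lines there, so the condition passes to \<open>\<psi>x\<close> and
  \<open>\<psi>t\<close>.\<close>

lemma test_function_derivatives_vanish:
  assumes "test_function \<psi> \<psi>x \<psi>t" "closed K" "\<And>z. z \<notin> K \<Longrightarrow> \<psi> z = 0" "z \<notin> K"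
  shows "\<psi>x z = 0" "\<psi>t z = 0"
proof -
  obtain x t where z: "z = (x, t)" by (cases z)
  have o: "open (- K)" using assms(2) by (simp add: open_Compl)
  have ox: "open {y. (y, t) \<in> - K}" and ot: "open {s. (x, s) \<in> - K}"
    using open_vimage[OF o, of "\<lambda>y. (y, t)"] open_vimage[OF o, of "\<lambda>s. (x, s)"]
    by (simp_all add: vimage_def continuous_on_Pair)
  have "((\<lambda>y. \<psi> (y, t)) has_real_derivative 0) (at x)"
    by (rule has_field_derivative_transform_within_open[OF DERIV_const[of 0] ox])
       (use assms(3,4) z in auto)
  moreover have "((\<lambda>s. \<psi> (x, s)) has_real_derivative 0) (at t)"
    by (rule has_field_derivative_transform_within_open[OF DERIV_const[of 0] ot])
       (use assms(3,4) z in auto)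
  ultimately show "\<psi>x z = 0" "\<psi>t z = 0"
    using assms(1) DERIV_unique unfolding z test_function_def by blast+
qed

text \<open>The chain rule needs a total derivative, but only partial derivatives are given; the
  continuity of \<open>\<psi>t\<close> supplies the total one.\<close>

lemma test_function_derivative_along_line:
  assumes "test_function \<psi> \<psi>x \<psi>t"
  shows "((\<lambda>s. \<psi> (y + \<sigma> * s, s)) has_real_derivative
           \<psi>t (y + \<sigma> * t, t) + \<sigma> * \<psi>x (y + \<sigma> * t, t)) (at t)"
proof -
  let ?p = "(y + \<sigma> * t, t)"
  \<comment> \<open>\<open>has_derivative_partialsI\<close> takes the second partial derivative as a
    continuous family of bounded linear maps, hence the multiple of
    \<open>id_blinfun\<close>.\<close>
  have "((\<lambda>(x, s). \<psi> (x, s)) has_derivative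
          (\<lambda>(h, k). \<psi>x ?p * h + (\<psi>t (fst ?p, snd ?p) *\<^sub>R id_blinfun) k))
         (at (y + \<sigma> * t, t) within UNIV \<times> UNIV)"
  proof (rule has_derivative_partialsI)
    show "((\<lambda>x. \<psi> (x, t)) has_derivative (*) (\<psi>x ?p)) (at (y + \<sigma> * t) within UNIV)"
      using assms by (simp add: test_function_def has_field_derivative_def)
    show "((\<lambda>s. \<psi> (x, s)) has_derivative
            blinfun_apply (\<psi>t (fst (x, s), snd (x, s)) *\<^sub>R id_blinfun)) (at s within UNIV)" for x s
      using assms
      by (simp add: test_function_def has_field_derivative_def scaleR_blinfun.rep_eq id_blinfun.rep_eq)
    have "continuous_on UNIV \<psi>t" using assms by (simp add: test_function_def)
    then have "continuous_on UNIV (\<lambda>z. \<psi>t z *\<^sub>R (id_blinfun :: real \<Rightarrow>\<^sub>L real))"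
      by (intro continuous_intros)
    then show "continuous (at (y + \<sigma> * t, t) within UNIV \<times> UNIV)
       (\<lambda>(x, s). \<psi>t (fst (x, s), snd (x, s)) *\<^sub>R (id_blinfun :: real \<Rightarrow>\<^sub>L real))"
      by (simp add: continuous_on_eq_continuous_at case_prod_unfold)
  qed auto
  then have "(\<psi> has_derivative (\<lambda>(h, k). \<psi>x ?p * h + \<psi>t ?p * k)) (at ?p)"
    by (simp add: case_prod_unfold scaleR_blinfun.rep_eq id_blinfun.rep_eq)
  moreover have "((\<lambda>s. (y + \<sigma> * s, s)) has_derivative (\<lambda>h. (\<sigma> * h, h))) (at t)"
    by (auto intro!: derivative_eq_intros)
  ultimately have "((\<lambda>s. \<psi> (y + \<sigma> * s, s)) has_derivative
      (\<lambda>h. \<psi>x ?p * (\<sigma> * h) + \<psi>t ?p * h)) (at t)"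
    by (auto dest: has_derivative_compose[rotated])
  moreover have "(\<lambda>h. \<psi>x ?p * (\<sigma> * h) + \<psi>t ?p * h) = (*) (\<psi>t ?p + \<sigma> * \<psi>x ?p)"
    by (auto simp: fun_eq_iff algebra_simps)
  ultimately show ?thesis
    by (simp add: has_field_derivative_def)
qed

lemma integrable_continuous_compact_support:
  fixes f :: "'a::euclidean_space \<Rightarrow> 'b::{banach, second_countable_topology}"
  assumes "continuous_on UNIV f" "compact K" "\<And>z. z \<notin> K \<Longrightarrow> f z = 0"
  shows "integrable lborel f"
proof -
  have "(\<lambda>z. indicator K z *\<^sub>R f z) = f"
    using assms(3) by (auto simp: fun_eq_iff indicator_def)
  then show ?thesis
    using borel_integrable_compact[of K f] assms continuous_on_subset by fastforce
qed

text \<open>Justifies splitting the integrals of the weak formulation by linearity. A time slice of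
  \<open>\<psi>\<close> is supported in the projection of the support to the space axis, which is
  compact.\<close>

lemma test_function_integrable:
  assumes "test_function \<psi> \<psi>x \<psi>t"
  shows "integrable lborel \<psi>x" "integrable lborel \<psi>t" "integrable lborel (\<lambda>x. \<psi> (x, t))"
proof -
  obtain K where K: "compact K" "\<And>z. z \<notin> K \<Longrightarrow> \<psi> z = 0"
    using assms by (auto simp: test_function_def)
  have c: "continuous_on UNIV \<psi>" "continuous_on UNIV \<psi>x" "continuous_on UNIV \<psi>t"
    using assms by (auto simp: test_function_def)
  show "integrable lborel \<psi>x" "integrable lborel \<psi>t"
    using integrable_continuous_compact_support[OF _ K(1)] c
      test_function_derivatives_vanish[OF assms compact_imp_closed[OF K(1)] K(2)] by auto
  have cK: "compact (fst ` K)"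
    using K(1) by (intro compact_continuous_image continuous_intros)
  have ct: "continuous_on UNIV (\<lambda>x. \<psi> (x, t))"
    by (rule continuous_on_compose2[OF c(1)]) (auto intro!: continuous_intros)
  have "\<psi> (x, t) = 0" if "x \<notin> fst ` K" for x
    using that K(2) by force
  then show "integrable lborel (\<lambda>x. \<psi> (x, t))"
    by (rule integrable_continuous_compact_support[OF ct cK])
qed

text \<open>After the shear \<open>(y, t) \<mapsto> (y + \<sigma> t, t)\<close> the integrand is a \<open>t\<close>-derivative.\<close>

lemma test_function_integral_sheared:
  assumes tf: "test_function \<psi> \<psi>x \<psi>t" and A: "A \<in> sets borel"
  shows "(LINT (x, t)|lborel. indicator A (x - \<sigma> * t) * indicator {0..} t * (\<psi>t (x, t) + \<sigma> * \<psi>x (x, t)))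
         = - (LINT x|lborel. indicator A x * \<psi> (x, 0))"
proof -
  obtain K where K: "compact K" "\<And>z. z \<notin> K \<Longrightarrow> \<psi> z = 0"
    using tf by (auto simp: test_function_def)
  note vanish = test_function_derivatives_vanish[OF tf compact_imp_closed[OF K(1)] K(2)]
  have c: "continuous_on UNIV \<psi>x" "continuous_on UNIV \<psi>t"
    using tf by (auto simp: test_function_def)
  define h where "h z = \<psi>t z + \<sigma> * \<psi>x z" for z
  have ch: "continuous_on UNIV h" unfolding h_def by (intro continuous_intros c)
  have [measurable]: "h \<in> borel_measurable borel" "A \<in> sets borel"
    using ch A by (auto intro: borel_measurable_continuous_onI)
  have hK: "h z = 0" if "z \<notin> K" for z using vanish that by (simp add: h_def)
  have ih: "integrable lborel h"
    by (rule integrable_continuous_compact_support[OF ch K(1) hK])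
  define g where "g = (\<lambda>(y, t). h (y + \<sigma> * t, t))"
  have cg: "continuous_on UNIV g"
    unfolding g_def case_prod_unfold
    by (rule continuous_on_compose2[OF ch]) (auto intro!: continuous_intros)
  have "compact ((\<lambda>(x, t). (x - \<sigma> * t, t)) ` K)"
    unfolding case_prod_unfold by (intro compact_continuous_image continuous_intros K)
  moreover have "g z = 0" if "z \<notin> (\<lambda>(x, t). (x - \<sigma> * t, t)) ` K" for z
  proof -
    have "(fst z + \<sigma> * snd z, snd z) \<notin> K"
    proof
      assume "(fst z + \<sigma> * snd z, snd z) \<in> K"
      from imageI[OF this, of "\<lambda>(x, t). (x - \<sigma> * t, t)"] that show False by simp
    qed
    then show ?thesis by (simp add: g_def hK case_prod_unfold)
  qed
  ultimately have ig: "integrable lborel g"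
    by (rule integrable_continuous_compact_support[OF cg])
  have [measurable]: "g \<in> borel_measurable borel"
    using cg by (auto intro: borel_measurable_continuous_onI)
  have borel_pair: "borel_measurable (borel \<Otimes>\<^sub>M borel) = (borel_measurable borel :: (real \<times> real \<Rightarrow> real) set)"
    by (simp add: borel_prod)
  \<comment> \<open>\<open>H\<close> is the integrand in the original coordinates, \<open>G\<close>
    in the sheared ones, where the moving set becomes the fixed set \<open>A\<close>.\<close>
  define H where "H = (\<lambda>x t. indicator A (x - \<sigma> * t) * indicator {0..} t * h (x, t))"
  define G where "G = (\<lambda>y t. indicator A y * indicator {0..} t * g (y, t))"
  have mH: "case_prod H \<in> borel_measurable (borel \<Otimes>\<^sub>M borel)"
    and mG: "case_prod G \<in> borel_measurable (borel \<Otimes>\<^sub>M borel)"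
    unfolding H_def G_def by measurable
  have iH: "integrable (lborel \<Otimes>\<^sub>M lborel) (case_prod H)"
    unfolding lborel_prod using mH
    by (intro Bochner_Integration.integrable_bound[OF ih]) (auto simp: borel_pair H_def indicator_def)
  have iG: "integrable (lborel \<Otimes>\<^sub>M lborel) (case_prod G)"
    unfolding lborel_prod using mG
    by (intro Bochner_Integration.integrable_bound[OF ig]) (auto simp: borel_pair G_def indicator_def)
  \<comment> \<open>At fixed time the shear is a translation of the line, so no two-dimensional
    change of variables is required.\<close>
  have shift: "(LINT x|lborel. H x t) = (LINT y|lborel. G y t)" for t
    by (subst lborel_integral_real_affine[of 1 _ "\<sigma> * t"])
       (simp_all add: H_def G_def g_def add.commute)
  have inner: "(LINT t|lborel. G y t) = - (indicator A y * \<psi> (y, 0))" for y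
  proof -
    have "bounded (snd ` K)"
      using K(1) by (intro compact_imp_bounded compact_continuous_image continuous_intros)
    then obtain B where B: "\<And>z. z \<in> K \<Longrightarrow> norm (snd z) \<le> B"
      by (auto simp: bounded_iff)
    \<comment> \<open>\<open>T\<close> lies beyond every time in the support, so the boundary term
      at \<open>T\<close> vanishes and \<open>{0..}\<close> may be cut to \<open>{0..T}\<close>. The
      maximum keeps \<open>T\<close> positive.\<close>
    define T where "T = max 1 (B + 1)"
    have T: "T > 0" "\<And>x t. T \<le> t \<Longrightarrow> (x, t) \<notin> K" using B by (fastforce simp: T_def)+
    have "(LINT t|lborel. g (y, t) * indicator {0..T} t) = \<psi> (y + \<sigma> * T, T) - \<psi> (y + \<sigma> * 0, 0)"
    proof (rule integral_FTC_Icc_real)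
      show "0 \<le> T" using T by simp
      show "((\<lambda>s. \<psi> (y + \<sigma> * s, s)) has_real_derivative g (y, t)) (at t)" for t
        using test_function_derivative_along_line[OF tf] by (simp add: g_def h_def)
      have "continuous_on UNIV (\<lambda>t. g (y, t))"
        by (rule continuous_on_compose2[OF cg]) (auto intro!: continuous_intros)
      then show "isCont (\<lambda>t. g (y, t)) t" for t
        by (simp add: continuous_on_eq_continuous_at)
    qed
    moreover have "\<psi> (y + \<sigma> * T, T) = 0" using K T by simp
    moreover have "G y t = indicator A y * (g (y, t) * indicator {0..T} t)" for t
      using T(2)[of t "y + \<sigma> * t"] hK by (auto simp: G_def g_def indicator_def)
    ultimately show ?thesis by simp
  qed
  \<comment> \<open>Space is integrated first so that \<open>shift\<close> applies; Fubini then
    makes time the inner variable for the fundamental theorem of calculus.\<close>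
  have "(LINT (x, t)|lborel. H x t) = (LINT t|lborel. LINT x|lborel. H x t)"
    using lborel_pair.integral_snd[OF iH] by (simp add: lborel_prod)
  also have "\<dots> = (LINT y|lborel. LINT t|lborel. G y t)"
    unfolding shift by (rule lborel_pair.Fubini_integral[OF iG])
  also have "\<dots> = - (LINT y|lborel. indicator A y * \<psi> (y, 0))"
    unfolding inner by simp
  finally show ?thesis by (simp add: H_def h_def)
qed

text \<open>By Rankine--Hugoniot the flux jumps by \<open>\<sigma>\<close> times the jump of the
  state. The jump is therefore tested against \<open>\<psi>t + \<sigma> * \<psi>x\<close>, the
  derivative along lines parallel to the shock, whose integral leaves only initial values.\<close>

lemma weak_solution_shock_wave:
  assumes ph: "\<Phi>m \<in> phase_space" "\<Phi>p \<in> phase_space"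
    and rh: "rankine_hugoniot w n \<Phi>m \<Phi>p \<sigma>"
  shows "weak_solution w n (riemann_data \<Phi>m \<Phi>p) (shock_wave \<sigma> \<Phi>m \<Phi>p)"
  unfolding weak_solution_def
proof (intro conjI allI impI)
  have "{z. fst z < \<sigma> * snd z} \<in> sets (borel :: (real \<times> real) measure)"
    by (intro borel_open open_Collect_less continuous_intros)
  then show "shock_wave \<sigma> \<Phi>m \<Phi>p \<in> borel_measurable borel"
    unfolding shock_wave_def case_prod_unfold by (intro measurable_If) auto
  show "shock_wave \<sigma> \<Phi>m \<Phi>p (x, t) \<in> phase_space" for x t
    using ph by (simp add: shock_wave_def)
next
  fix \<psi> \<psi>x \<psi>t assume tf: "test_function \<psi> \<psi>x \<psi>t"
  note int = test_function_integrable[OF tf]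
  \<comment> \<open>Speeds \<open>0\<close> and \<open>1\<close> with \<open>A = UNIV\<close> give the integrals of \<open>\<psi>t\<close> and \<open>\<psi>t + \<psi>x\<close> over the
    half plane, which cover the constant part of the solution; \<open>A = {0..}\<close> covers the jump.\<close>
  define P where "P = (\<lambda>A s. \<lambda>(x, t). indicator A (x - s * t) * indicator {0..} t * (\<psi>t (x, t) + s * \<psi>x (x, t)))"
  have P: "(LINT z|lborel. P A s z) = - (LINT x|lborel. indicator A x * \<psi> (x, 0))"
    if "A \<in> sets borel" for A s
    using test_function_integral_sheared[OF tf that] by (simp add: P_def)
  have iP: "integrable lborel (P A s)" if [measurable]: "A \<in> sets borel" for A s
  proof -
    have [measurable]: "\<psi>x \<in> borel_measurable borel" "\<psi>t \<in> borel_measurable borel"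
      using int by auto
    have "P A s \<in> borel_measurable (borel \<Otimes>\<^sub>M borel)" unfolding P_def by measurable
    then have m: "P A s \<in> borel_measurable borel" by (simp add: borel_prod)
    have "integrable lborel (\<lambda>z. \<psi>t z + s * \<psi>x z)" using int by simp
    then show ?thesis
      by (rule Bochner_Integration.integrable_bound) (use m in \<open>auto simp: P_def indicator_def\<close>)
  qed
  define F where "F = flux w n \<Phi>m"
  define D where "D = \<Phi>p - \<Phi>m"
  have fp: "flux w n \<Phi>p = F + \<sigma> *\<^sub>R D"
    using rh by (simp add: rankine_hugoniot_def F_def D_def algebra_simps)
  have p: "\<Phi>p = \<Phi>m + D" by (simp add: D_def)
  define U where "U = shock_wave \<sigma> \<Phi>m \<Phi>p"
  \<comment> \<open>Expressed through \<open>\<psi>t\<close> and \<open>\<psi>t + \<psi>x\<close>,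
    the constant part has coefficients \<open>\<Phi>m - F\<close> and \<open>F\<close>; to the right
    of the shock, \<open>fp\<close> contributes the remaining term.\<close>
  have "indicator (UNIV \<times> {0..}) z *\<^sub>R (\<psi>t z *\<^sub>R U z + \<psi>x z *\<^sub>R flux w n (U z))
      = P UNIV 0 z *\<^sub>R (\<Phi>m - F) + P UNIV 1 z *\<^sub>R F + P {0..} \<sigma> z *\<^sub>R D" for z
    by (cases z) (auto simp: U_def shock_wave_def P_def indicator_def fp F_def[symmetric] D_def algebra_simps)
  then have "(LINT z:UNIV \<times> {0..}|lborel. \<psi>t z *\<^sub>R U z + \<psi>x z *\<^sub>R flux w n (U z))
      = (LINT z|lborel. P UNIV 0 z *\<^sub>R (\<Phi>m - F) + P UNIV 1 z *\<^sub>R F + P {0..} \<sigma> z *\<^sub>R D)"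
    by (simp add: set_lebesgue_integral_def)
  also have "\<dots> = (LINT z|lborel. P UNIV 0 z) *\<^sub>R (\<Phi>m - F) + (LINT z|lborel. P UNIV 1 z) *\<^sub>R F
      + (LINT z|lborel. P {0..} \<sigma> z) *\<^sub>R D"
    by (simp add: iP)
  \<comment> \<open>\<open>P UNIV 0\<close> and \<open>P UNIV 1\<close> have the same integral, so
    \<open>F\<close> cancels.\<close>
  also have "\<dots> = - ((LINT x|lborel. \<psi> (x, 0)) *\<^sub>R \<Phi>m + (LINT x|lborel. indicator {0..} x * \<psi> (x, 0)) *\<^sub>R D)"
    by (simp add: P algebra_simps)
  also have "\<dots> = - (LINT x|lborel. \<psi> (x, 0) *\<^sub>R riemann_data \<Phi>m \<Phi>p x)"
  proof -
    have i: "integrable lborel (\<lambda>x. indicator {0..} x * \<psi> (x, 0))"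
      using integrable_mult_indicator[OF _ int(3)[of 0], of "{0..}"] by simp
    have "(LINT x|lborel. \<psi> (x, 0) *\<^sub>R riemann_data \<Phi>m \<Phi>p x)
        = (LINT x|lborel. \<psi> (x, 0) *\<^sub>R \<Phi>m + (indicator {0..} x * \<psi> (x, 0)) *\<^sub>R D)"
      by (intro Bochner_Integration.integral_cong)
         (auto simp: riemann_data_def p indicator_def algebra_simps)
    then show ?thesis using i int(3)[of 0] by simp
  qed
  finally show "(LINT z:UNIV \<times> {0..}|lborel. \<psi>t z *\<^sub>R shock_wave \<sigma> \<Phi>m \<Phi>p z
        + \<psi>x z *\<^sub>R flux w n (shock_wave \<sigma> \<Phi>m \<Phi>p z))
      + (LINT x|lborel. \<psi> (x, 0) *\<^sub>R riemann_data \<Phi>m \<Phi>p x) = 0"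
    by (simp add: U_def)
qed

subsection \<open>The Hugoniot locus of the origin\<close>

lemma powr_less_iff_base:
  fixes x y a :: real
  assumes "0 < x" "0 < y" "0 < a"
  shows "x powr a < y powr a \<longleftrightarrow> x < y"
  using assms powr_less_mono2[of a x y] powr_mono2[of a y x] by (meson leD less_eq_real_def not_le)

lemma rankine_hugoniot_origin_iff:
  "rankine_hugoniot w n 0 \<Phi> \<sigma> \<longleftrightarrow> (\<forall>i. \<Phi> $ i * vel w n i \<Phi> = \<sigma> * \<Phi> $ i)"
  by (simp add: rankine_hugoniot_def flux_def vec_eq_iff)

section \<open>Eigenvalues on the branches of the locus\<close>

text \<open>The Jacobian matrix is triangular on the edge: one eigenvalue is the velocity of the
  absent species, the other, \<open>c\<close>, is the derivative of the scalar flux of the present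
  one. Their order varies along the edge, hence \<open>min\<close> and \<open>max\<close>.\<close>

lemma lam_edge1:
  fixes w n :: "real^2"
  assumes "\<Phi> $ 2 = 0"
  defines "c \<equiv> vel w n 1 \<Phi> - n $ 1 * \<Phi> $ 1 * slip w n 1 \<Phi>"
  shows "lam1 w n \<Phi> = min (vel w n 2 \<Phi>) c" and "lam2 w n \<Phi> = max (vel w n 2 \<Phi>) c"
proof -
  have "discr w n \<Phi> = (c - vel w n 2 \<Phi>)\<^sup>2"
    by (simp add: discr_def c_def vel_def assms power2_eq_square algebra_simps)
  then show "lam1 w n \<Phi> = min (vel w n 2 \<Phi>) c" and "lam2 w n \<Phi> = max (vel w n 2 \<Phi>) c"
    by (auto simp: lam1_def lam2_def c_def assms field_simps min_def max_def)
qed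

lemma lam_edge2:
  fixes w n :: "real^2"
  assumes "\<Phi> $ 1 = 0"
  defines "c \<equiv> vel w n 2 \<Phi> - n $ 2 * \<Phi> $ 2 * slip w n 2 \<Phi>"
  shows "lam1 w n \<Phi> = min (vel w n 1 \<Phi>) c" and "lam2 w n \<Phi> = max (vel w n 1 \<Phi>) c"
proof -
  have "discr w n \<Phi> = (c - vel w n 1 \<Phi>)\<^sup>2"
    by (simp add: discr_def c_def vel_def assms power2_eq_square algebra_simps)
  then show "lam1 w n \<Phi> = min (vel w n 1 \<Phi>) c" and "lam2 w n \<Phi> = max (vel w n 1 \<Phi>) c"
    by (auto simp: lam1_def lam2_def c_def assms field_simps min_def max_def)
qed

text \<open>With equal slips the discriminant is the square of a sum, and the sign hypothesis
  removes the absolute value from its root. The larger eigenvalue is then the common velocity of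
  both species, which is why the shock speed equals \<open>lam2\<close> on the level sets.\<close>

lemma lam_equal_slip:
  assumes "slip w n 1 \<Phi> = u" "slip w n 2 \<Phi> = u" "0 \<le> (n $ 1 * \<Phi> $ 1 + n $ 2 * \<Phi> $ 2) * u"
  shows "lam1 w n \<Phi> = (1 - conc \<Phi>) * u - (n $ 1 * \<Phi> $ 1 + n $ 2 * \<Phi> $ 2) * u"
    and "lam2 w n \<Phi> = (1 - conc \<Phi>) * u"
proof -
  have "discr w n \<Phi> = ((n $ 1 * \<Phi> $ 1 + n $ 2 * \<Phi> $ 2) * u)\<^sup>2"
    by (simp add: discr_def assms(1,2) power2_eq_square algebra_simps)
  then have "sqrt (discr w n \<Phi>) = (n $ 1 * \<Phi> $ 1 + n $ 2 * \<Phi> $ 2) * u"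
    using assms(3) by simp
  then show "lam1 w n \<Phi> = (1 - conc \<Phi>) * u - (n $ 1 * \<Phi> $ 1 + n $ 2 * \<Phi> $ 2) * u"
    and "lam2 w n \<Phi> = (1 - conc \<Phi>) * u"
    by (simp_all add: lam1_def lam2_def vel_def conc_def assms(1,2) algebra_simps)
qed

lemma edge1_iff: "\<Phi> \<in> edge1 \<longleftrightarrow> \<Phi> $ 2 = 0 \<and> 0 \<le> \<Phi> $ 1 \<and> \<Phi> $ 1 \<le> 1"
  by (auto simp: edge1_def vec_eq_iff forall_2)

lemma edge2_iff: "\<Phi> \<in> edge2 \<longleftrightarrow> \<Phi> $ 1 = 0 \<and> 0 \<le> \<Phi> $ 2 \<and> \<Phi> $ 2 \<le> 1"
  by (auto simp: edge2_def vec_eq_iff forall_2)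

section \<open>Threshold concentrations for slips and speeds\<close>

context
  fixes w n :: "real^2"
  assumes w: "w $ 2 < w $ 1" "0 < w $ 2"
    and n: "n $ 2 < n $ 1" "1 < n $ 2"
begin

lemma slip_pos:
  assumes "conc \<Phi> < 1"
  shows "0 < slip w n i \<Phi>"
  using assms w exhaust_2[of i] by (auto simp: slip_def)

text \<open>On the edge of species \<open>i\<close> this product is the shock speed; a single power
  of \<open>1 - conc \<Phi>\<close> makes its comparisons monotone.\<close>

lemma conc_times_slip:
  assumes "conc \<Phi> < 1"
  shows "(1 - conc \<Phi>) * slip w n i \<Phi> = w $ i * (1 - conc \<Phi>) powr (n $ i)"
  using assms by (simp add: slip_def powr_diff field_simps)

lemma phi_x_range: "0 < phi_x w n" "phi_x w n < 1"
  using w n by (auto simp: phi_x_def powr01_less_one)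

text \<open>The base \<open>w $ 2 / w $ 1\<close> lies below 1, so the larger exponent
  \<open>1 / (n $ 1 - n $ 2)\<close> gives the smaller power.\<close>

lemma phi_sigma_range: "0 < phi_sigma w n" "phi_sigma w n < phi_x w n"
  using w n powr_less_mono'[of "w $ 2 / w $ 1" "1 / n $ 1" "1 / (n $ 1 - n $ 2)"]
  by (auto simp: phi_x_def phi_sigma_def powr01_less_one field_simps)

text \<open>Writing \<open>w $ 2\<close> as \<open>w $ 1\<close> times a power of
  \<open>1 - phi_x w n\<close> exposes a common positive factor of both slips. What remains compares
  \<open>1 - conc \<Phi>\<close> with \<open>1 - phi_x w n\<close> under the positive exponent
  \<open>n $ 1 - n $ 2\<close>.\<close>

lemma slip_less_iff:
  assumes "conc \<Phi> < 1"
  shows "slip w n 2 \<Phi> < slip w n 1 \<Phi> \<longleftrightarrow> conc \<Phi> < phi_x w n"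
    and "slip w n 1 \<Phi> < slip w n 2 \<Phi> \<longleftrightarrow> phi_x w n < conc \<Phi>"
proof -
  define d r where "d = 1 - conc \<Phi>" and "r = 1 - phi_x w n"
  have pos: "d > 0" "r > 0" using assms phi_x_range by (auto simp: d_def r_def)
  have r: "w $ 2 = w $ 1 * r powr (n $ 1 - n $ 2)"
    using w n by (simp add: r_def phi_x_def powr_powr)
  have s: "slip w n 1 \<Phi> = w $ 1 * d powr (n $ 2 - 1) * d powr (n $ 1 - n $ 2)"
    by (simp add: slip_def d_def flip: powr_add)
  have t: "slip w n 2 \<Phi> = w $ 1 * d powr (n $ 2 - 1) * r powr (n $ 1 - n $ 2)"
    using r by (simp add: slip_def d_def)
  have c: "0 < w $ 1 * d powr (n $ 2 - 1)" using w pos by simp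
  show "slip w n 2 \<Phi> < slip w n 1 \<Phi> \<longleftrightarrow> conc \<Phi> < phi_x w n"
    and "slip w n 1 \<Phi> < slip w n 2 \<Phi> \<longleftrightarrow> phi_x w n < conc \<Phi>"
    unfolding s t mult_less_cancel_left_pos[OF c]
    using n pos by (simp_all add: powr_less_iff_base d_def r_def)
qed

lemma slip_eq_iff:
  assumes "conc \<Phi> \<le> 1"
  shows "slip w n 1 \<Phi> = slip w n 2 \<Phi> \<longleftrightarrow> conc \<Phi> = phi_x w n \<or> conc \<Phi> = 1"
proof (cases "conc \<Phi> = 1")
  case True
  \<comment> \<open>Both slips vanish here because \<open>0 powr a = 0\<close>.\<close>
  then show ?thesis by (simp add: slip_def)
next
  case False
  then show ?thesis using assms slip_less_iff[of \<Phi>] by linarith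
qed

text \<open>\<open>phi_sigma w n\<close> is the concentration at which the shock speed on the first
  edge equals \<open>w $ 2\<close>, the smaller eigenvalue at the origin.\<close>

lemma speed1_less_iff:
  assumes "conc \<Phi> < 1"
  shows "(1 - conc \<Phi>) * slip w n 1 \<Phi> < w $ 2 \<longleftrightarrow> phi_sigma w n < conc \<Phi>"
    and "w $ 2 < (1 - conc \<Phi>) * slip w n 1 \<Phi> \<longleftrightarrow> conc \<Phi> < phi_sigma w n"
proof -
  define s where "s = 1 - phi_sigma w n"
  have s: "s > 0" using phi_x_range phi_sigma_range by (simp add: s_def)
  have w2: "w $ 2 = w $ 1 * s powr (n $ 1)"
    using w n by (simp add: s_def phi_sigma_def powr_powr)
  have c: "0 < w $ 1" using w by simp
  show "(1 - conc \<Phi>) * slip w n 1 \<Phi> < w $ 2 \<longleftrightarrow> phi_sigma w n < conc \<Phi>"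
    and "w $ 2 < (1 - conc \<Phi>) * slip w n 1 \<Phi> \<longleftrightarrow> conc \<Phi> < phi_sigma w n"
    unfolding conc_times_slip[OF assms] w2 mult_less_cancel_left_pos[OF c]
    using n assms s by (simp_all add: powr_less_iff_base, simp_all add: s_def)
qed

lemma speed_less:
  assumes "0 < conc \<Phi>" "conc \<Phi> < 1"
  shows "(1 - conc \<Phi>) * slip w n i \<Phi> < w $ i"
proof -
  have "(1 - conc \<Phi>) powr (n $ i) < 1" "0 < w $ i"
    using n w assms exhaust_2[of i] by (auto simp: powr01_less_one)
  then show ?thesis using assms by (simp add: conc_times_slip)
qed

text \<open>The origin lies on the first edge, where the two candidates of \<open>lam_edge1\<close>
  reduce to \<open>w $ 2\<close> and \<open>w $ 1\<close>.\<close>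

lemma lam_origin: "lam1 w n 0 = w $ 2" "lam2 w n 0 = w $ 1"
  using w by (simp_all add: lam_edge1 vel_def slip_def conc_def)

lemma hugoniot_origin:
  "hugoniot w n 0 = edge1 \<union> edge2 \<union> level_set (phi_x w n) \<union> level_set 1" (is "_ = ?R")
proof (intro set_eqI iffI)
  fix \<Phi> assume "\<Phi> \<in> hugoniot w n 0"
  then obtain \<sigma> where ph: "\<Phi> \<in> phase_space"
    and rh: "\<Phi> $ 1 * vel w n 1 \<Phi> = \<sigma> * \<Phi> $ 1" "\<Phi> $ 2 * vel w n 2 \<Phi> = \<sigma> * \<Phi> $ 2"
    by (auto simp: hugoniot_def rankine_hugoniot_origin_iff)
  show "\<Phi> \<in> ?R"
  proof (cases "\<Phi> $ 1 = 0 \<or> \<Phi> $ 2 = 0")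
    case True
    then show ?thesis using ph by (auto simp: edge1_iff edge2_iff phase_space_def conc_def)
  next
    case False
    then have "vel w n 1 \<Phi> = vel w n 2 \<Phi>" using rh by simp
    then have "slip w n 1 \<Phi> = slip w n 2 \<Phi>" by (simp add: vel_def)
    then show ?thesis using ph slip_eq_iff[of \<Phi>] by (auto simp: level_set_def phase_space_def)
  qed
next
  fix \<Phi> assume A: "\<Phi> \<in> ?R"
  then have ph: "\<Phi> \<in> phase_space"
    by (auto simp: edge1_iff edge2_iff level_set_def phase_space_def conc_def)
  \<comment> \<open>The common velocity serves as shock speed on the level sets; on an edge it is
    the velocity of the present species.\<close>
  have "vel w n 1 \<Phi> = vel w n 2 \<Phi>" if "\<Phi> \<in> level_set (phi_x w n) \<union> level_set 1"
    using that slip_eq_iff[of \<Phi>] by (auto simp: level_set_def vel_def phase_space_def)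
  then have "\<exists>\<sigma>. \<Phi> $ 1 * vel w n 1 \<Phi> = \<sigma> * \<Phi> $ 1 \<and> \<Phi> $ 2 * vel w n 2 \<Phi> = \<sigma> * \<Phi> $ 2"
    using A by (auto simp: edge1_iff edge2_iff mult.commute)
  then show "\<Phi> \<in> hugoniot w n 0"
    using ph by (auto simp: hugoniot_def rankine_hugoniot_origin_iff forall_2)
qed

section \<open>Shock speed against the eigenvalues, branch by branch\<close>

text \<open>The speed is the common velocity, hence \<open>lam2\<close>. Its distance to
  \<open>lam1\<close> is a positive multiple of the common slip, which vanishes exactly for
  \<open>c = 1\<close>.\<close>

lemma level_set_shock:
  assumes "\<Phi> \<in> level_set c" "c = phi_x w n \<or> c = 1" "rankine_hugoniot w n 0 \<Phi> \<sigma>"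
  shows "\<sigma> = lam2 w n \<Phi>" "\<sigma> < w $ 2"
    and "c = 1 \<Longrightarrow> lam1 w n \<Phi> = \<sigma>" "c < 1 \<Longrightarrow> lam1 w n \<Phi> < \<sigma>"
proof -
  have \<Phi>: "0 \<le> \<Phi> $ 1" "0 \<le> \<Phi> $ 2" "conc \<Phi> = c" "0 < c"
    using assms phi_x_range by (auto simp: level_set_def phase_space_def)
  define u where "u = slip w n 1 \<Phi>"
  have u: "slip w n 1 \<Phi> = u" "slip w n 2 \<Phi> = u"
    using slip_eq_iff[of \<Phi>] assms(2) \<Phi> phi_x_range by (auto simp: u_def)
  have u0: "0 \<le> u" "c = 1 \<Longrightarrow> u = 0" "c < 1 \<Longrightarrow> 0 < u"
    using w slip_pos[of \<Phi> 1] \<Phi> by (auto simp: u_def slip_def)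
  have N: "0 < n $ 1 * \<Phi> $ 1 + n $ 2 * \<Phi> $ 2"
    using \<Phi> n by (cases "\<Phi> $ 1 = 0") (auto simp: conc_def intro!: add_pos_nonneg)
  have v: "vel w n 1 \<Phi> = (1 - c) * u" "vel w n 2 \<Phi> = (1 - c) * u"
    by (simp_all add: vel_def u conc_def algebra_simps flip: \<Phi>(3))
  \<comment> \<open>Since \<open>0 < c\<close>, some component of \<open>\<Phi>\<close> is nonzero
    and can be cancelled.\<close>
  have "\<sigma> = (1 - c) * u"
    using assms(3) \<Phi>(3,4) by (auto simp: rankine_hugoniot_origin_iff forall_2 v conc_def)
  note this[simp]
  have l: "lam1 w n \<Phi> = (1 - c) * u - (n $ 1 * \<Phi> $ 1 + n $ 2 * \<Phi> $ 2) * u"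
     "lam2 w n \<Phi> = (1 - c) * u"
    using lam_equal_slip[OF u] N u0(1) \<Phi>(3) by simp_all
  show "\<sigma> = lam2 w n \<Phi>" by (simp add: l)
  show "c = 1 \<Longrightarrow> lam1 w n \<Phi> = \<sigma>" using u0 by (simp add: l)
  show "c < 1 \<Longrightarrow> lam1 w n \<Phi> < \<sigma>" using u0 N by (simp add: l)
  \<comment> \<open>For \<open>c = 1\<close> the speed is 0; otherwise the bound for species 2
    applies because the slips agree.\<close>
  show "\<sigma> < w $ 2"
    using speed_less[of \<Phi> 2] \<Phi> u assms(2) w phi_x_range by (cases "c = 1") auto
qed

text \<open>The eigenvalues at \<open>\<Phi>\<close> are \<open>\<sigma>\<close> minus a positive
  term and \<open>\<sigma>\<close> plus the difference of slip 2 and slip 1. The first puts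
  \<open>lam1\<close> below \<open>\<sigma>\<close>; the sign of the difference decides on which
  side \<open>lam2\<close> lies.\<close>

lemma edge1_shock:
  assumes "\<Phi> $ 2 = 0" "0 < \<Phi> $ 1" "\<Phi> $ 1 < 1" "rankine_hugoniot w n 0 \<Phi> \<sigma>"
  shows "\<sigma> < w $ 1"
    and "\<sigma> < w $ 2 \<longleftrightarrow> phi_sigma w n < \<Phi> $ 1" "w $ 2 < \<sigma> \<longleftrightarrow> \<Phi> $ 1 < phi_sigma w n"
    and "lam1 w n \<Phi> < \<sigma>"
    and "lam2 w n \<Phi> < \<sigma> \<longleftrightarrow> \<Phi> $ 1 < phi_x w n" "\<sigma> < lam2 w n \<Phi> \<longleftrightarrow> phi_x w n < \<Phi> $ 1"
proof -
  have c: "conc \<Phi> = \<Phi> $ 1" using assms by (simp add: conc_def)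
  have v: "\<sigma> = vel w n 1 \<Phi>" using assms by (simp add: rankine_hugoniot_origin_iff forall_2)
  have s: "\<sigma> = (1 - conc \<Phi>) * slip w n 1 \<Phi>"
    using assms by (simp add: v vel_def conc_def algebra_simps)
  have v2: "vel w n 2 \<Phi> = \<sigma> + (slip w n 2 \<Phi> - slip w n 1 \<Phi>)" by (simp add: v vel_def)
  have p: "0 < n $ 1 * \<Phi> $ 1 * slip w n 1 \<Phi>" using assms n slip_pos[of \<Phi> 1] c by simp
  show "\<sigma> < w $ 1" using speed_less[of \<Phi> 1] assms c s by simp
  show "\<sigma> < w $ 2 \<longleftrightarrow> phi_sigma w n < \<Phi> $ 1" "w $ 2 < \<sigma> \<longleftrightarrow> \<Phi> $ 1 < phi_sigma w n"
    using speed1_less_iff[of \<Phi>] assms c s by auto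
  show "lam1 w n \<Phi> < \<sigma>" "lam2 w n \<Phi> < \<sigma> \<longleftrightarrow> \<Phi> $ 1 < phi_x w n"
    "\<sigma> < lam2 w n \<Phi> \<longleftrightarrow> phi_x w n < \<Phi> $ 1"
    unfolding lam_edge1[OF assms(1)] using p slip_less_iff[of \<Phi>] assms c v v2 by auto
qed

text \<open>Here the slip difference enters with the opposite sign, which reverses the comparisons
  at \<open>phi_x w n\<close>. The speed always stays below \<open>w $ 2\<close>, so no analogue of
  \<open>phi_sigma w n\<close> occurs.\<close>

lemma edge2_shock:
  assumes "\<Phi> $ 1 = 0" "0 < \<Phi> $ 2" "\<Phi> $ 2 < 1" "rankine_hugoniot w n 0 \<Phi> \<sigma>"
  shows "\<sigma> < w $ 2" and "lam1 w n \<Phi> < \<sigma>"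
    and "lam2 w n \<Phi> < \<sigma> \<longleftrightarrow> phi_x w n < \<Phi> $ 2" "\<sigma> < lam2 w n \<Phi> \<longleftrightarrow> \<Phi> $ 2 < phi_x w n"
proof -
  have c: "conc \<Phi> = \<Phi> $ 2" using assms by (simp add: conc_def)
  have v: "\<sigma> = vel w n 2 \<Phi>" using assms by (simp add: rankine_hugoniot_origin_iff forall_2)
  have s: "\<sigma> = (1 - conc \<Phi>) * slip w n 2 \<Phi>"
    using assms by (simp add: v vel_def conc_def algebra_simps)
  have v1: "vel w n 1 \<Phi> = \<sigma> + (slip w n 1 \<Phi> - slip w n 2 \<Phi>)" by (simp add: v vel_def)
  have p: "0 < n $ 2 * \<Phi> $ 2 * slip w n 2 \<Phi>" using assms n slip_pos[of \<Phi> 2] c by simp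
  show "\<sigma> < w $ 2" using speed_less[of \<Phi> 2] assms c s by simp
  show "lam1 w n \<Phi> < \<sigma>" "lam2 w n \<Phi> < \<sigma> \<longleftrightarrow> phi_x w n < \<Phi> $ 2"
    "\<sigma> < lam2 w n \<Phi> \<longleftrightarrow> \<Phi> $ 2 < phi_x w n"
    unfolding lam_edge2[OF assms(1)] using p slip_less_iff[of \<Phi>] assms c v v1 by auto
qed

end

text \<open>For nonzero \<open>\<Phi>\<close> the Rankine--Hugoniot condition determines
  \<open>\<sigma>\<close>. At \<open>\<Phi> = 0\<close> every \<open>\<sigma>\<close> satisfies it;
  the wave is then constant, and every case of the classification requires positive
  concentration.\<close>

theorem theorem2:
  fixes w n :: "real^2"
  assumes "w $ 1 > w $ 2" "w $ 2 > 0"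
    and "n $ 1 > n $ 2" "n $ 2 > 1"
  shows
    "hugoniot w n 0 = edge1 \<union> edge2 \<union> level_set (phi_x w n) \<union> level_set 1 \<and>
     (\<forall>\<Phi> \<in> hugoniot w n 0. \<forall>\<sigma>. rankine_hugoniot w n 0 \<Phi> \<sigma> \<longrightarrow>
        weak_solution w n (riemann_data 0 \<Phi>) (shock_wave \<sigma> 0 \<Phi>) \<and>
        (\<Phi> \<in> edge1 \<longrightarrow>
           (0 < \<Phi> $ 1 \<and> \<Phi> $ 1 < phi_sigma w n \<longrightarrow>
              lax_2 w n 0 \<Phi> \<sigma> \<and>
              lam1 w n \<Phi> \<le> \<sigma> \<and> lam2 w n \<Phi> \<le> \<sigma> \<and> \<sigma> < lam2 w n 0 \<and> lam1 w n 0 < \<sigma>) \<and>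
           (\<Phi> $ 1 = phi_sigma w n \<longrightarrow>
              lax_2 w n 0 \<Phi> \<sigma> \<and>
              lam1 w n \<Phi> \<le> \<sigma> \<and> lam2 w n \<Phi> \<le> \<sigma> \<and> \<sigma> < lam2 w n 0 \<and> lam1 w n 0 = \<sigma>) \<and>
           (phi_sigma w n < \<Phi> $ 1 \<and> \<Phi> $ 1 < phi_x w n \<longrightarrow>
              overcompressive w n 0 \<Phi> \<sigma> \<and>
              lam1 w n \<Phi> < \<sigma> \<and> lam2 w n \<Phi> < \<sigma> \<and> \<sigma> < lam1 w n 0 \<and> \<sigma> < lam2 w n 0) \<and>
           (\<Phi> $ 1 = phi_x w n \<longrightarrow>
              lax_1 w n 0 \<Phi> \<sigma> \<and>
              lam1 w n \<Phi> < \<sigma> \<and> \<sigma> < lam1 w n 0 \<and> \<sigma> < lam2 w n 0 \<and> \<sigma> = lam2 w n \<Phi>) \<and>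
           (\<Phi> $ 1 = 1 \<longrightarrow>
              lax_1 w n 0 \<Phi> \<sigma> \<and>
              lam1 w n \<Phi> = \<sigma> \<and> \<sigma> < lam1 w n 0 \<and> \<sigma> < lam2 w n 0 \<and> \<sigma> = lam2 w n \<Phi>) \<and>
           (phi_x w n < \<Phi> $ 1 \<and> \<Phi> $ 1 < 1 \<longrightarrow>
              lax_1 w n 0 \<Phi> \<sigma> \<and>
              lam1 w n \<Phi> < \<sigma> \<and> \<sigma> < lam1 w n 0 \<and> \<sigma> < lam2 w n 0 \<and> \<sigma> < lam2 w n \<Phi>)) \<and>
        (\<Phi> \<in> edge2 \<longrightarrow>
           (0 < \<Phi> $ 2 \<and> \<Phi> $ 2 < phi_x w n \<longrightarrow>
              lax_1 w n 0 \<Phi> \<sigma> \<and>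
              lam1 w n \<Phi> < \<sigma> \<and> \<sigma> < lam1 w n 0 \<and> \<sigma> < lam2 w n 0 \<and> \<sigma> < lam2 w n \<Phi>) \<and>
           (\<Phi> $ 2 = phi_x w n \<longrightarrow>
              lax_1 w n 0 \<Phi> \<sigma> \<and>
              lam1 w n \<Phi> < \<sigma> \<and> \<sigma> < lam1 w n 0 \<and> \<sigma> < lam2 w n 0 \<and> \<sigma> = lam2 w n \<Phi>) \<and>
           (\<Phi> $ 2 = 1 \<longrightarrow>
              lax_1 w n 0 \<Phi> \<sigma> \<and>
              lam1 w n \<Phi> = \<sigma> \<and> \<sigma> < lam1 w n 0 \<and> \<sigma> < lam2 w n 0 \<and> \<sigma> = lam2 w n \<Phi>) \<and>
           (phi_x w n < \<Phi> $ 2 \<and> \<Phi> $ 2 < 1 \<longrightarrow>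
              overcompressive w n 0 \<Phi> \<sigma> \<and>
              lam1 w n \<Phi> < \<sigma> \<and> lam2 w n \<Phi> < \<sigma> \<and> \<sigma> < lam1 w n 0 \<and> \<sigma> < lam2 w n 0)) \<and>
        (\<Phi> \<in> level_set (phi_x w n) \<longrightarrow>
           lax_1 w n 0 \<Phi> \<sigma> \<and>
           lam1 w n \<Phi> < \<sigma> \<and> \<sigma> < lam1 w n 0 \<and> \<sigma> < lam2 w n 0 \<and> \<sigma> = lam2 w n \<Phi>) \<and>
        (\<Phi> \<in> level_set 1 \<longrightarrow>
           lax_1 w n 0 \<Phi> \<sigma> \<and>
           lam1 w n \<Phi> = \<sigma> \<and> \<sigma> < lam1 w n 0 \<and> \<sigma> < lam2 w n 0 \<and> \<sigma> = lam2 w n \<Phi>))"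
proof -
  note par = assms
  note lam0 = lam_origin[OF par]
  note range = phi_x_range[OF par] phi_sigma_range[OF par]
  note e1 = edge1_shock[OF par] and e2 = edge2_shock[OF par] and lev = level_set_shock[OF par]
  have levx: "lax_1 w n 0 \<Phi> \<sigma> \<and> lam1 w n \<Phi> < \<sigma> \<and> \<sigma> < lam1 w n 0 \<and> \<sigma> < lam2 w n 0 \<and> \<sigma> = lam2 w n \<Phi>"
    if "\<Phi> \<in> level_set (phi_x w n)" "rankine_hugoniot w n 0 \<Phi> \<sigma>" for \<Phi> \<sigma>
    using lev[OF that(1) _ that(2)] range par that(2) by (auto simp: lax_1_def lam0)
  have lev1: "lax_1 w n 0 \<Phi> \<sigma> \<and> lam1 w n \<Phi> = \<sigma> \<and> \<sigma> < lam1 w n 0 \<and> \<sigma> < lam2 w n 0 \<and> \<sigma> = lam2 w n \<Phi>"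
    if "\<Phi> \<in> level_set 1" "rankine_hugoniot w n 0 \<Phi> \<sigma>" for \<Phi> \<sigma>
    using lev[OF that(1) _ that(2)] par that(2) by (auto simp: lax_1_def lam0)
  \<comment> \<open>Edge points of concentration \<open>phi_x w n\<close> or 1 also lie on a level
    set, so \<open>levx\<close> and \<open>lev1\<close> settle those cases.\<close>
  have edge1_level: "\<Phi> \<in> level_set (\<Phi> $ 1)" if "\<Phi> \<in> edge1" for \<Phi>
    using that by (auto simp: edge1_iff level_set_def phase_space_def conc_def)
  have edge2_level: "\<Phi> \<in> level_set (\<Phi> $ 2)" if "\<Phi> \<in> edge2" for \<Phi>
    using that by (auto simp: edge2_iff level_set_def phase_space_def conc_def)
  have origin: "0 \<in> phase_space" by (simp add: phase_space_def conc_def)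
  show ?thesis
  \<comment> \<open>The instantiated rules split off only the equation for the locus and keep the
    classification as one goal.\<close>
  proof (intro conjI[of "_ = _"] ballI allI impI[of "rankine_hugoniot _ _ _ _ _"], goal_cases)
    case 1
    show ?case by (rule hugoniot_origin[OF par])
  next
    case (2 \<Phi> \<sigma>)
    then have weak: "weak_solution w n (riemann_data 0 \<Phi>) (shock_wave \<sigma> 0 \<Phi>)"
      using origin by (auto simp: hugoniot_def intro: weak_solution_shock_wave)
    have "lax_2 w n 0 \<Phi> \<sigma> \<and>
          lam1 w n \<Phi> \<le> \<sigma> \<and> lam2 w n \<Phi> \<le> \<sigma> \<and> \<sigma> < lam2 w n 0 \<and> lam1 w n 0 < \<sigma>"
      if "\<Phi> \<in> edge1" "0 < \<Phi> $ 1 \<and> \<Phi> $ 1 < phi_sigma w n"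
      using that e1[of \<Phi> \<sigma>] 2(2) range by (auto simp: lax_2_def lam0 edge1_iff)
    \<comment> \<open>The equality with \<open>lam1 w n 0\<close> holds because both strict
      comparisons of \<open>\<sigma>\<close> with \<open>w $ 2\<close> fail at the
      threshold.\<close>
    moreover have "lax_2 w n 0 \<Phi> \<sigma> \<and>
          lam1 w n \<Phi> \<le> \<sigma> \<and> lam2 w n \<Phi> \<le> \<sigma> \<and> \<sigma> < lam2 w n 0 \<and> lam1 w n 0 = \<sigma>"
      if "\<Phi> \<in> edge1" "\<Phi> $ 1 = phi_sigma w n"
      using that e1[of \<Phi> \<sigma>] 2(2) range by (auto simp: lax_2_def lam0 edge1_iff)
    moreover have "overcompressive w n 0 \<Phi> \<sigma> \<and>
          lam1 w n \<Phi> < \<sigma> \<and> lam2 w n \<Phi> < \<sigma> \<and> \<sigma> < lam1 w n 0 \<and> \<sigma> < lam2 w n 0"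
      if "\<Phi> \<in> edge1" "phi_sigma w n < \<Phi> $ 1 \<and> \<Phi> $ 1 < phi_x w n"
      using that e1[of \<Phi> \<sigma>] 2(2) range by (auto simp: overcompressive_def lam0 edge1_iff)
    moreover have "lax_1 w n 0 \<Phi> \<sigma> \<and>
          lam1 w n \<Phi> < \<sigma> \<and> \<sigma> < lam1 w n 0 \<and> \<sigma> < lam2 w n 0 \<and> \<sigma> < lam2 w n \<Phi>"
      if "\<Phi> \<in> edge1" "phi_x w n < \<Phi> $ 1 \<and> \<Phi> $ 1 < 1"
      using that e1[of \<Phi> \<sigma>] 2(2) range by (auto simp: lax_1_def lam0 edge1_iff)
    moreover have "lax_1 w n 0 \<Phi> \<sigma> \<and>
          lam1 w n \<Phi> < \<sigma> \<and> \<sigma> < lam1 w n 0 \<and> \<sigma> < lam2 w n 0 \<and> \<sigma> < lam2 w n \<Phi>"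
      if "\<Phi> \<in> edge2" "0 < \<Phi> $ 2 \<and> \<Phi> $ 2 < phi_x w n"
      using that e2[of \<Phi> \<sigma>] 2(2) range par by (auto simp: lax_1_def lam0 edge2_iff)
    moreover have "overcompressive w n 0 \<Phi> \<sigma> \<and>
          lam1 w n \<Phi> < \<sigma> \<and> lam2 w n \<Phi> < \<sigma> \<and> \<sigma> < lam1 w n 0 \<and> \<sigma> < lam2 w n 0"
      if "\<Phi> \<in> edge2" "phi_x w n < \<Phi> $ 2 \<and> \<Phi> $ 2 < 1"
      using that e2[of \<Phi> \<sigma>] 2(2) range par by (auto simp: overcompressive_def lam0 edge2_iff)
    ultimately show ?case
      using weak levx[OF _ 2(2)] lev1[OF _ 2(2)] edge1_level[of \<Phi>] edge2_level[of \<Phi>] by metis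
  qed
qed

end
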